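(* Let $\eta$ and $\beta$ be nonzero (real or complex) constants, and let $\alpha$ be a (real or complex) constant with $\alpha\neq-1$ and $\alpha\ne-\beta-1$. Then $$\int x^\alpha \cosh(\eta x^\beta)\,dx=\frac{x^{\alpha+1}}{(\alpha+1)(\alpha+\beta+1)}\Bigl[\cosh(\eta x^\beta)\;{}_1F_2\Bigl(1; \frac{\alpha+\beta+1}{2\beta}, \frac{\alpha+2\beta+1}{2\beta}; \frac{\eta^2 x^{2\beta}}{4}\Bigr)- \beta\eta x^{\beta}\sinh(\eta x^\beta)\;{}_1F_2\Bigl(1; \frac{\alpha+2\beta+1}{2\beta}, \frac{\alpha+3\beta+1}{2\beta}; \frac{\eta^2 x^{2\beta}}{4}\Bigr)\Bigr]+C,$$ where $C$ is an arbitrary constant of integration.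
   Context: The hypergeometric function ${}_1F_2$ is ${}_1F_2(a;b,c;x)=\sum_{n=0}^{\infty}\frac{(a)_n}{(b)_n(c)_n}\frac{x^n}{n!}$, where $(\vartheta)_n=\Gamma(\vartheta+n)/\Gamma(\vartheta)$, $(\vartheta)_0=1$ (Pochhammer symbol). The integral is an indefinite integral (antiderivative) with respect to $x$.
   Formalization: The printed formula is false (e.g. α=0, β=η=1); the cosh term is multiplied by the missing factor α+β+1. The lower parameters (α+β+1)/(2β), (α+2β+1)/(2β) are assumed not to be nonpositive integers, so that the ₁F₂ exist. Powers are principal, x≠0. *)

theory Defs
  imports "HOL-Analysis.Analysis"
begin

(* The value is meaningful only if neither b nor c is a nonpositive integer:
   otherwise "pochhammer b n * pochhammer c n" vanishes for large n and division
   by zero would silently truncate the series. *)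
definition hypergeom_1F2 :: "'a::{real_normed_field,banach} \<Rightarrow> 'a \<Rightarrow> 'a \<Rightarrow> 'a \<Rightarrow> 'a" where
  "hypergeom_1F2 a b c x =
     (\<Sum>n. pochhammer a n / (pochhammer b n * pochhammer c n) * (x ^ n / fact n))"

(* The antiderivatives of f on S are exactly the functions F + C with C constant on S;
   C = 0 gives that F itself is an antiderivative.
   For S contained in the real line, "at x within S" makes this the derivative with respect
   to a real variable of a complex-valued function. *)
definition has_indefinite_integral_on ::
    "('a::real_normed_field \<Rightarrow> 'a) \<Rightarrow> ('a \<Rightarrow> 'a) \<Rightarrow> 'a set \<Rightarrow> bool" where
  "has_indefinite_integral_on f F S \<longleftrightarrow>
     (\<forall>G. (\<forall>x\<in>S. (G has_field_derivative f x) (at x within S)) \<longleftrightarrow>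
          (\<exists>C. \<forall>x\<in>S. G x = F x + C))"

end

theory Submission
  imports Defs
begin

text \<open>
  Put p = (\<alpha> + 1)/\<beta>, u = \<eta> x^\<beta> and G(u) = \<Sum> u^n / (p + 1)_n. By the duplication formula
  for Pochhammer symbols, the two hypergeometric series are, up to an elementary factor, the even
  and the odd part of G, so the claimed antiderivative is
  x^(\<alpha> + 1) / (\<alpha> + 1) (H(u) + H(-u)) / 2 with H(u) = exp(-u) G(u). Comparing coefficients gives
  p G + u G' = p + u G, hence p H + u H' = p exp(-u), and the derivative follows. All three domains
  are starlike, so antiderivatives on them are unique up to a constant.
\<close>

section \<open>The series G(u): convergence and differential equation\<close>

lemma pochhammer_neq_0_if_not_nonpos_Int:
  fixes q :: "'a::field_char_0"
  assumes "q \<notin> \<int>\<^sub>\<le>\<^sub>0"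
  shows "pochhammer q n \<noteq> 0"
  using assms by (auto simp: pochhammer_eq_0_iff)

text \<open>This is Kummer's function 1F1(1; q; u), which is exp u for q = 1. At a nonpositive
  integer q it becomes a polynomial in u, since \<open>inverse 0 = 0\<close>.\<close>

definition pochhammer_exp :: "'a::{real_normed_field,banach} \<Rightarrow> 'a \<Rightarrow> 'a" where
  "pochhammer_exp q u = (\<Sum>n. inverse (pochhammer q n) * u ^ n)"

lemma summable_pochhammer_exp:
  fixes q u :: "'a::{real_normed_field,banach}"
  shows "summable (\<lambda>n. inverse (pochhammer q n) * u ^ n)"
proof (rule summable_ratio_test)
  show "(1/2::real) < 1" by simp
next
  \<comment> \<open>From this index on, |q + n| \<ge> n - |q| \<ge> 2|u| + 1, so the ratio |u| / |q
    + n| is at most 1/2; the extra 1 keeps the denominator nonzero when u = 0.\<close>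
  fix n assume n: "nat \<lceil>2 * norm u + norm q + 1\<rceil> \<le> n"
  have "2 * norm u + norm q + 1 \<le> real n"
    using n by linarith
  moreover have "real n - norm q \<le> norm (q + of_nat n)"
    by (metis add.commute norm_diff_ineq norm_of_nat)
  ultimately have *: "2 * norm u + 1 \<le> norm (q + of_nat n)" by linarith
  then have "norm u / norm (q + of_nat n) \<le> 1/2"
    using norm_ge_zero[of u] by (subst divide_le_eq) (auto intro: add_nonneg_pos)
  then have "norm (inverse (pochhammer q n) * u ^ n) * (norm u / norm (q + of_nat n))
      \<le> norm (inverse (pochhammer q n) * u ^ n) * (1/2)"
    by (rule mult_left_mono) simp
  moreover have "inverse (pochhammer q (Suc n)) * u ^ Suc n
      = inverse (pochhammer q n) * u ^ n * (u / (q + of_nat n))"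
    by (simp add: pochhammer_Suc inverse_eq_divide)
  ultimately show "norm (inverse (pochhammer q (Suc n)) * u ^ Suc n)
      \<le> 1/2 * norm (inverse (pochhammer q n) * u ^ n)"
    by (simp only: norm_mult norm_divide mult.commute)
qed

text \<open>The operator p + u d/du multiplies the n-th coefficient by p + n, which turns 1/(p +
  1)_n into the preceding coefficient. The relation is left undivided by u so that it also covers u
  = 0.\<close>

lemma DERIV_pochhammer_exp:
  fixes p u :: "'a::{real_normed_field,banach}"
  assumes "p + 1 \<notin> \<int>\<^sub>\<le>\<^sub>0"
  obtains D where "(pochhammer_exp (p + 1) has_field_derivative D) (at u)"
    "p * pochhammer_exp (p + 1) u + u * D = p + u * pochhammer_exp (p + 1) u"
proof
  define c where "c = (\<lambda>n. inverse (pochhammer (p + 1) n))"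
  have sm: "summable (\<lambda>n. c n * v ^ n)" for v
    unfolding c_def by (rule summable_pochhammer_exp)
  have G: "pochhammer_exp (p + 1) = (\<lambda>v. \<Sum>n. c n * v ^ n)"
    by (simp add: fun_eq_iff pochhammer_exp_def c_def)
  show "(pochhammer_exp (p + 1) has_field_derivative (\<Sum>n. diffs c n * u ^ n)) (at u)"
    unfolding G by (rule termdiffs_strong_converges_everywhere) (rule sm)
  have nz: "pochhammer (p + 1) n \<noteq> 0" for n
    using assms by (rule pochhammer_neq_0_if_not_nonpos_Int)
  have rec: "(p + of_nat (Suc n)) * c (Suc n) = c n" for n
    using nz[of n] nz[of "Suc n"] unfolding c_def pochhammer_Suc by (simp add: field_simps)
  have smd: "summable (\<lambda>n. diffs c n * u ^ n)"
    by (rule termdiff_converges_all) (rule sm)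
  have sm': "summable (\<lambda>n. c (Suc n) * u ^ Suc n)"
    using sm[of u] by (subst summable_Suc_iff)
  \<comment> \<open>Splitting off the constant term yields the lone p on the right and aligns the
    remaining powers with those of u G'.\<close>
  have "p * (\<Sum>n. c n * u ^ n) = p * (1 + (\<Sum>n. c (Suc n) * u ^ Suc n))"
    using suminf_split_head[OF sm[of u]] by (simp add: c_def)
  also have "\<dots> + u * (\<Sum>n. diffs c n * u ^ n)
      = p + (\<Sum>n. p * (c (Suc n) * u ^ Suc n) + u * (diffs c n * u ^ n))"
    by (simp add: suminf_add[symmetric] summable_mult sm' smd suminf_mult distrib_left del: power_Suc)
  also have "(\<lambda>n. p * (c (Suc n) * u ^ Suc n) + u * (diffs c n * u ^ n))
      = (\<lambda>n. u * (c n * u ^ n))"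
  proof
    fix n
    have "p * (c (Suc n) * u ^ Suc n) + u * (diffs c n * u ^ n)
        = u * ((p + of_nat (Suc n)) * c (Suc n) * u ^ n)"
      by (simp add: diffs_def algebra_simps)
    then show "p * (c (Suc n) * u ^ Suc n) + u * (diffs c n * u ^ n) = u * (c n * u ^ n)"
      by (simp only: rec)
  qed
  also have "p + suminf \<dots> = p + u * (\<Sum>n. c n * u ^ n)"
    by (simp add: suminf_mult sm)
  finally show "p * pochhammer_exp (p + 1) u + u * (\<Sum>n. diffs c n * u ^ n)
      = p + u * pochhammer_exp (p + 1) u"
    by (simp add: G)
qed

section \<open>Even and odd parts of G as hypergeometric series\<close>

text \<open>Odd powers cancel. In the even ones, duplication splits (q)_2k into 4^k (q/2)_k
  ((q+1)/2)_k; the argument u^2/4 absorbs 4^k, and (1)_k cancels k!.\<close>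

lemma pochhammer_exp_even_part:
  fixes q u :: "'a::{real_normed_field,banach}"
  shows "hypergeom_1F2 1 (q / 2) ((q + 1) / 2) (u\<^sup>2 / 4)
    = (pochhammer_exp q u + pochhammer_exp q (- u)) / 2"
proof -
  define f where "f = (\<lambda>n. (inverse (pochhammer q n) * u ^ n + inverse (pochhammer q n) * (- u) ^ n) / 2)"
  have "f sums ((pochhammer_exp q u + pochhammer_exp q (- u)) / 2)"
    unfolding f_def pochhammer_exp_def
    by (intro sums_divide sums_add summable_sums summable_pochhammer_exp)
  moreover have "f n = 0" if "n \<notin> range (\<lambda>k. 2 * k)" for n
  proof -
    have "odd n"
      using that by (auto simp: dvd_def)
    then show ?thesis
      by (simp add: f_def)
  qed
  moreover have "strict_mono (\<lambda>k::nat. 2 * k)"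
    by (simp add: strict_mono_def)
  ultimately have "(\<lambda>k. f (2 * k)) sums ((pochhammer_exp q u + pochhammer_exp q (- u)) / 2)"
    by (subst sums_mono_reindex) auto
  moreover have "f (2 * k) = pochhammer 1 k / (pochhammer (q / 2) k * pochhammer ((q + 1) / 2) k)
      * ((u\<^sup>2 / 4) ^ k / fact k)" for k
  proof -
    have "pochhammer q (2 * k) = 4 ^ k * (pochhammer (q / 2) k * pochhammer ((q + 1) / 2) k)"
      using pochhammer_double[of "q / 2" k] by (simp add: power_mult add_divide_distrib)
    moreover have "f (2 * k) = u ^ (2 * k) / pochhammer q (2 * k)"
      by (simp add: f_def) (simp add: divide_inverse mult.commute)
    moreover have "pochhammer 1 k = (fact k :: 'a)"
      by (simp add: pochhammer_fact)
    ultimately show ?thesis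
      by (simp add: power_mult power_divide)
  qed
  ultimately have "(\<lambda>k. pochhammer 1 k / (pochhammer (q / 2) k * pochhammer ((q + 1) / 2) k)
      * ((u\<^sup>2 / 4) ^ k / fact k)) sums ((pochhammer_exp q u + pochhammer_exp q (- u)) / 2)"
    by (simp only:)
  then show ?thesis
    unfolding hypergeom_1F2_def by (rule sums_unique[symmetric])
qed

text \<open>Since (q)_(n+1) = q (q+1)_n, removing the constant term leaves a multiple of u. That
  factor swaps parity, so the odd part at q comes from the even part at q + 1.\<close>

lemma pochhammer_exp_shift:
  "pochhammer_exp q u = 1 + u / q * pochhammer_exp (q + 1) u"
proof -
  have "pochhammer_exp q u = 1 + (\<Sum>n. inverse (pochhammer q (Suc n)) * u ^ Suc n)"
    unfolding pochhammer_exp_def by (subst suminf_split_head) (simp_all add: summable_pochhammer_exp)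
  also have "(\<lambda>n. inverse (pochhammer q (Suc n)) * u ^ Suc n)
      = (\<lambda>n. u / q * (inverse (pochhammer (q + 1) n) * u ^ n))"
    by (simp add: fun_eq_iff pochhammer_rec divide_inverse mult_ac)
  also have "suminf \<dots> = u / q * pochhammer_exp (q + 1) u"
    unfolding pochhammer_exp_def by (rule suminf_mult) (rule summable_pochhammer_exp)
  finally show ?thesis .
qed

lemma pochhammer_exp_odd_part:
  "u / q * hypergeom_1F2 1 ((q + 1) / 2) ((q + 2) / 2) (u\<^sup>2 / 4)
    = (pochhammer_exp q u - pochhammer_exp q (- u)) / 2"
proof -
  have "pochhammer_exp q u - pochhammer_exp q (- u)
      = u / q * (pochhammer_exp (q + 1) u + pochhammer_exp (q + 1) (- u))"
    by (simp add: pochhammer_exp_shift[of q] distrib_left)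
  then show ?thesis
    using pochhammer_exp_even_part[of "q + 1" u, unfolded add.assoc one_add_one] by (simp only: times_divide_eq_right)
qed

section \<open>Differentiating the closed form\<close>

text \<open>The factor exp(-u) contributes -u G through the product rule, which cancels the u G in
  the equation for G and leaves an elementary right-hand side.\<close>

lemma DERIV_exp_pochhammer_exp:
  fixes p u :: "'a::{real_normed_field,banach}"
  assumes "p + 1 \<notin> \<int>\<^sub>\<le>\<^sub>0"
  obtains D where "((\<lambda>v. exp (- v) * pochhammer_exp (p + 1) v) has_field_derivative D) (at u)"
    "p * (exp (- u) * pochhammer_exp (p + 1) u) + u * D = p * exp (- u)"
proof -
  obtain D where D: "(pochhammer_exp (p + 1) has_field_derivative D) (at u)"
    and eq: "p * pochhammer_exp (p + 1) u + u * D = p + u * pochhammer_exp (p + 1) u"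
    using DERIV_pochhammer_exp[OF assms] .
  have "((\<lambda>v. exp (- v) * pochhammer_exp (p + 1) v) has_field_derivative
      exp (- u) * (D - pochhammer_exp (p + 1) u)) (at u)"
    by (rule derivative_eq_intros D refl)+ (simp add: algebra_simps)
  moreover have "p * (exp (- u) * pochhammer_exp (p + 1) u)
      + u * (exp (- u) * (D - pochhammer_exp (p + 1) u))
    = p * exp (- u)"
  proof -
    have "p * (exp (- u) * pochhammer_exp (p + 1) u)
        + u * (exp (- u) * (D - pochhammer_exp (p + 1) u))
      = exp (- u) * (p * pochhammer_exp (p + 1) u + u * D - u * pochhammer_exp (p + 1) u)"
      by (simp add: algebra_simps)
    then show ?thesis
      unfolding eq by (simp add: mult.commute)
  qed
  ultimately show ?thesis
    by (rule that)
qed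

text \<open>Both sides are the even part of exp(-u) G(u): in (cosh u - sinh u) times (even part +
  odd part of G), the products of equal parity are the even ones.\<close>

lemma cosh_sinh_hypergeom_1F2_eq:
  fixes q u :: "'a::{real_normed_field,banach}"
  shows "cosh u * hypergeom_1F2 1 (q / 2) ((q + 1) / 2) (u\<^sup>2 / 4)
      - u / q * sinh u * hypergeom_1F2 1 ((q + 1) / 2) ((q + 2) / 2) (u\<^sup>2 / 4)
    = (exp (- u) * pochhammer_exp q u + exp u * pochhammer_exp q (- u)) / 2"
proof -
  have "cosh u * hypergeom_1F2 1 (q / 2) ((q + 1) / 2) (u\<^sup>2 / 4)
      - u / q * sinh u * hypergeom_1F2 1 ((q + 1) / 2) ((q + 2) / 2) (u\<^sup>2 / 4)
    = cosh u * hypergeom_1F2 1 (q / 2) ((q + 1) / 2) (u\<^sup>2 / 4)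
      - sinh u * (u / q * hypergeom_1F2 1 ((q + 1) / 2) ((q + 2) / 2) (u\<^sup>2 / 4))"
    by (simp add: mult_ac)
  also have "\<dots> = (exp (- u) * pochhammer_exp q u + exp u * pochhammer_exp q (- u)) / 2"
    unfolding pochhammer_exp_even_part pochhammer_exp_odd_part
    by (simp add: cosh_field_def sinh_field_def field_simps)
  finally show ?thesis .
qed

text \<open>Here f and u stand for x^s and \<eta> x^\<beta>. Only their logarithmic derivatives s/x
  and \<beta>/x enter, so the argument does not depend on a branch of the power.\<close>

lemma DERIV_cosh_sinh_hypergeom_1F2:
  fixes u f :: "'a::{real_normed_field,banach} \<Rightarrow> 'a"
  assumes "\<beta> \<noteq> 0" "s \<noteq> 0" "s / \<beta> + 1 \<notin> \<int>\<^sub>\<le>\<^sub>0" "x \<noteq> 0"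
    and f: "(f has_field_derivative s * f x / x) (at x within S)"
    and u: "(u has_field_derivative \<beta> * u x / x) (at x within S)"
  shows "((\<lambda>x. f x / s * (cosh (u x) * hypergeom_1F2 1 ((s / \<beta> + 1) / 2) ((s / \<beta> + 2) / 2) ((u x)\<^sup>2 / 4)
      - u x / (s / \<beta> + 1) * sinh (u x)
        * hypergeom_1F2 1 ((s / \<beta> + 2) / 2) ((s / \<beta> + 3) / 2) ((u x)\<^sup>2 / 4)))
    has_field_derivative f x / x * cosh (u x)) (at x within S)"
proof -
  define p where "p = s / \<beta>"
  define H where "H = (\<lambda>v. exp (- v) * pochhammer_exp (p + 1) v)"
  have p: "p + 1 \<notin> \<int>\<^sub>\<le>\<^sub>0" and s: "s = p * \<beta>"
    using assms by (simp_all add: p_def)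
  obtain D where D: "(H has_field_derivative D) (at (u x))"
    and D_eq: "p * H (u x) + u x * D = p * exp (- u x)"
    unfolding H_def by (rule DERIV_exp_pochhammer_exp[OF p])
  obtain E where E: "(H has_field_derivative E) (at (- u x))"
    and E_eq: "p * H (- u x) - u x * E = p * exp (u x)"
    using DERIV_exp_pochhammer_exp[OF p, of "- u x"] unfolding H_def by auto
  have u': "((\<lambda>x. - u x) has_field_derivative - (\<beta> * u x / x)) (at x within S)"
    using u by (rule DERIV_minus)
  have "((\<lambda>x. f x / s * ((H (u x) + H (- u x)) / 2)) has_field_derivative
      s * f x / x / s * ((H (u x) + H (- u x)) / 2)
      + (D * (\<beta> * u x / x) + E * (- (\<beta> * u x / x))) / 2 * (f x / s)) (at x within S)"
    by (intro DERIV_mult DERIV_cdivide DERIV_add f DERIV_chain2[OF D u] DERIV_chain2[OF E u'])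
  \<comment> \<open>With s = p \<beta>, the derivative regroups into the left-hand sides of the
    equations for H at u and at -u. Their right-hand sides add up to 2 p cosh u.\<close>
  also have "s * f x / x / s * ((H (u x) + H (- u x)) / 2)
      + (D * (\<beta> * u x / x) + E * (- (\<beta> * u x / x))) / 2 * (f x / s)
    = f x * \<beta> / (2 * x * s) * ((p * H (u x) + u x * D) + (p * H (- u x) - u x * E))"
    using assms by (simp add: s field_simps)
  also have "\<dots> = f x / x * cosh (u x)"
    unfolding D_eq E_eq using assms by (simp add: s cosh_field_def field_simps)
  also have "(\<lambda>x. f x / s * ((H (u x) + H (- u x)) / 2))
    = (\<lambda>x. f x / s * (cosh (u x) * hypergeom_1F2 1 ((p + 1) / 2) ((p + 2) / 2) ((u x)\<^sup>2 / 4)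
      - u x / (p + 1) * sinh (u x) * hypergeom_1F2 1 ((p + 2) / 2) ((p + 3) / 2) ((u x)\<^sup>2 / 4)))"
  proof -
    have "p + 1 + 1 = p + 2" "p + 1 + 2 = p + 3"
      by simp_all
    with cosh_sinh_hypergeom_1F2_eq[of "u _" "p + 1"] show ?thesis
      by (simp only: H_def minus_minus)
  qed
  finally show ?thesis
    unfolding p_def .
qed

section \<open>Uniqueness of antiderivatives up to a constant\<close>

text \<open>The difference of two antiderivatives has derivative 0 along each segment from the
  centre, so it equals its value at the centre everywhere. Derivatives within S admit half-lines,
  which have empty interior in the complex plane.\<close>

lemma has_indefinite_integral_on_starlike:
  fixes f F :: "'a::real_normed_field \<Rightarrow> 'a"
  assumes "starlike S" and F: "\<And>x. x \<in> S \<Longrightarrow> (F has_field_derivative f x) (at x within S)"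
  shows "has_indefinite_integral_on f F S"
  unfolding has_indefinite_integral_on_def
proof (intro allI iffI)
  fix G assume G: "\<forall>x\<in>S. (G has_field_derivative f x) (at x within S)"
  from \<open>starlike S\<close> obtain a where a: "a \<in> S" "\<And>x. x \<in> S \<Longrightarrow> closed_segment a x \<subseteq> S"
    unfolding starlike_def by blast
  have "G x - F x = G a - F a" if "x \<in> S" for x
  proof -
    have "\<exists>C. \<forall>y\<in>closed_segment a x. G y - F y = C"
    proof (rule has_field_derivative_zero_constant)
      fix y assume "y \<in> closed_segment a x"
      with a that have "y \<in> S" by blast
      with G F have "((\<lambda>y. G y - F y) has_field_derivative f y - f y) (at y within S)"
        by (intro DERIV_diff) auto
      then show "((\<lambda>y. G y - F y) has_field_derivative 0) (at y within closed_segment a x)"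
        using a that by (auto intro: DERIV_subset)
    qed simp
    then show ?thesis by auto
  qed
  then have "\<forall>x\<in>S. G x = F x + (G a - F a)" by (simp add: algebra_simps)
  then show "\<exists>C. \<forall>x\<in>S. G x = F x + C" by blast
next
  fix G assume "\<exists>C. \<forall>x\<in>S. G x = F x + C"
  then obtain C where C: "\<And>x. x \<in> S \<Longrightarrow> G x = F x + C" by blast
  show "\<forall>x\<in>S. (G has_field_derivative f x) (at x within S)"
  proof
    fix x assume "x \<in> S"
    have "((\<lambda>x. F x + C) has_field_derivative f x) (at x within S)"
      using DERIV_add[OF F[OF \<open>x \<in> S\<close>] DERIV_const[of C]] by simp
    then show "(G has_field_derivative f x) (at x within S)"
      by (rule has_field_derivative_transform_within[OF _ zero_less_one \<open>x \<in> S\<close>]) (simp add: C)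
  qed
qed

section \<open>The domains and the principal power on them\<close>

text \<open>The half-lines are linear images of convex real sets; the slit plane is not convex, so
  starlikeness is the property shared by all three.\<close>

lemma starlike_slit_plane_or_half_line:
  assumes "S \<in> {- \<real>\<^sub>\<le>\<^sub>0, of_real ` {0<..}, of_real ` {..<0}}"
  shows "starlike (S :: complex set)"
proof -
  have "convex (of_real ` I :: complex set)" if "convex I" for I :: "real set"
    using that linear_of_real by (rule convex_linear_image[rotated])
  moreover have "- \<real>\<^sub>\<le>\<^sub>0 = - (complex_of_real ` {..0})"
    by (auto simp: nonpos_Reals_def)
  moreover have "starlike (- (complex_of_real ` {..0}))"
    using starlike_slotted_complex_plane_left[of 0] by simp
  ultimately show ?thesis
    using assms by (auto intro: convex_imp_starlike)
qed

text \<open>Ln is discontinuous across the negative half-line, but along it Ln x = Ln (-x) + \<i> pi.\<close>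

lemma has_field_derivative_Ln_slit_plane_or_half_line:
  assumes S: "S \<in> {- \<real>\<^sub>\<le>\<^sub>0, of_real ` {0<..}, of_real ` {..<0}}" and "x \<in> S"
  shows "(Ln has_field_derivative 1 / x) (at x within S)"
proof (cases "x \<in> \<real>\<^sub>\<le>\<^sub>0")
  case False
  then show ?thesis
    by (auto intro!: derivative_eq_intros simp: divide_inverse)
next
  case True
  with assms have S_eq: "S = of_real ` {..<0}"
    by (auto simp: complex_nonpos_Reals_iff)
  have "((\<lambda>y. Ln (- y) + \<i> * pi) has_field_derivative 1 / x) (at x within S)"
    using \<open>x \<in> S\<close> by (auto intro!: derivative_eq_intros simp: S_eq complex_nonpos_Reals_iff divide_inverse)
  moreover have "Ln (- y) + \<i> * pi = Ln y" if "y \<in> S" for y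
    using that Ln_minus[of "- y"] by (auto simp: S_eq)
  ultimately show ?thesis
    using has_field_derivative_transform_within[OF _ zero_less_one \<open>x \<in> S\<close>] by blast
qed

lemma has_field_derivative_powr_slit_plane_or_half_line:
  fixes a x :: complex
  assumes S: "S \<in> {- \<real>\<^sub>\<le>\<^sub>0, of_real ` {0<..}, of_real ` {..<0}}" and "x \<in> S"
  shows "((\<lambda>x. x powr a) has_field_derivative a * x powr a / x) (at x within S)"
proof -
  have nz: "y \<noteq> 0" if "y \<in> S" for y
    using S that by auto
  have "((\<lambda>x. exp (a * Ln x)) has_field_derivative a * exp (a * Ln x) / x) (at x within S)"
    using DERIV_chain2[OF DERIV_exp
        DERIV_cmult[OF has_field_derivative_Ln_slit_plane_or_half_line[OF assms], of a]]
    by (simp add: mult.commute)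
  then have "((\<lambda>x. x powr a) has_field_derivative a * exp (a * Ln x) / x) (at x within S)"
    by (rule has_field_derivative_transform_within[OF _ zero_less_one \<open>x \<in> S\<close>])
      (simp add: powr_def nz)
  then show ?thesis
    using nz[OF \<open>x \<in> S\<close>] by (simp add: powr_def)
qed

section \<open>The antiderivative for principal powers\<close>

text \<open>The domains cover complex x off the cut of the principal power, and real x of either
  sign. The conditions on two parameters keep every Pochhammer denominator nonzero, the remaining
  parameter being the first plus 1. The factor \<open>\<alpha> + \<beta> + 1\<close> on the cosh
  term, absent from the displayed formula, gives the limit x^(\<alpha>+1)/(\<alpha>+1) as \<eta>
  tends to 0, as integrating x^\<alpha> demands.\<close>

theorem proposition2:
  fixes \<alpha> \<beta> \<eta> :: complex and S :: "complex set"
  assumes "\<eta> \<noteq> 0" and "\<beta> \<noteq> 0"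
    and "\<alpha> \<noteq> -1" and "\<alpha> \<noteq> - \<beta> - 1"
    and "(\<alpha> + \<beta> + 1) / (2 * \<beta>) \<notin> \<int>\<^sub>\<le>\<^sub>0"
    and "(\<alpha> + 2 * \<beta> + 1) / (2 * \<beta>) \<notin> \<int>\<^sub>\<le>\<^sub>0"
    and "S \<in> {- \<real>\<^sub>\<le>\<^sub>0, of_real ` {0<..}, of_real ` {..<0}}"
  shows "has_indefinite_integral_on
    (\<lambda>x. x powr \<alpha> * cosh (\<eta> * x powr \<beta>))
    (\<lambda>x. x powr (\<alpha> + 1) / ((\<alpha> + 1) * (\<alpha> + \<beta> + 1)) *
      ((\<alpha> + \<beta> + 1) * cosh (\<eta> * x powr \<beta>) *
         hypergeom_1F2 1 ((\<alpha> + \<beta> + 1) / (2 * \<beta>)) ((\<alpha> + 2 * \<beta> + 1) / (2 * \<beta>))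
           (\<eta>\<^sup>2 * x powr (2 * \<beta>) / 4)
       - \<beta> * \<eta> * x powr \<beta> * sinh (\<eta> * x powr \<beta>) *
         hypergeom_1F2 1 ((\<alpha> + 2 * \<beta> + 1) / (2 * \<beta>)) ((\<alpha> + 3 * \<beta> + 1) / (2 * \<beta>))
           (\<eta>\<^sup>2 * x powr (2 * \<beta>) / 4)))
    S"
proof (rule has_indefinite_integral_on_starlike)
  show "starlike S"
    using assms(7) by (rule starlike_slit_plane_or_half_line)
next
  fix x assume "x \<in> S"
  with assms(7) have "x \<noteq> 0" by auto
  \<comment> \<open>This is p + 1 for p = (\<alpha> + 1)/\<beta>, the parameter of G; all
    hypergeometric parameters are half-integer shifts of q/2.\<close>
  define q where "q = (\<alpha> + 1) / \<beta> + 1"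
  have params: "(\<alpha> + \<beta> + 1) / (2 * \<beta>) = q / 2" "(\<alpha> + 2 * \<beta> + 1) / (2 * \<beta>) = (q + 1) / 2"
    "(\<alpha> + 3 * \<beta> + 1) / (2 * \<beta>) = (q + 2) / 2"
    and \<beta>_q: "\<alpha> + \<beta> + 1 = \<beta> * q"
    using \<open>\<beta> \<noteq> 0\<close> by (simp_all add: q_def field_simps)
  have "q \<noteq> 0"
    using assms(5) unfolding params by auto
  have "\<alpha> + 1 \<noteq> 0"
    using assms(3) by (simp add: add_eq_0_iff2)
  \<comment> \<open>If q = -n, then q/2 is a nonpositive integer for even n and (q + 1)/2 is one for
    odd n, so the two parameter conditions together exclude both cases.\<close>
  have q: "q \<notin> \<int>\<^sub>\<le>\<^sub>0"
  proof
    assume "q \<in> \<int>\<^sub>\<le>\<^sub>0"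
    then obtain n where n: "q = - of_nat n" by (auto elim!: nonpos_Ints_cases')
    show False
    proof (cases "even n")
      case True
      then have "q / 2 = - of_nat (n div 2)" by (auto simp: n elim!: evenE)
      with assms(5) show False by (simp add: params)
    next
      case False
      then have "(q + 1) / 2 = - of_nat (n div 2)" by (auto simp: n elim!: oddE)
      with assms(6) show False by (simp add: params)
    qed
  qed
  note powr = has_field_derivative_powr_slit_plane_or_half_line[OF assms(7) \<open>x \<in> S\<close>]
  have u: "((\<lambda>x. \<eta> * x powr \<beta>) has_field_derivative \<beta> * (\<eta> * x powr \<beta>) / x) (at x within S)"
    using DERIV_cmult[OF powr, of \<eta> \<beta>] by (simp add: mult_ac)
  have u_sq: "\<eta>\<^sup>2 * y powr (2 * \<beta>) = (\<eta> * y powr \<beta>)\<^sup>2" for y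
    using powr_add[of y \<beta> \<beta>] by (simp add: power2_eq_square mult_2[symmetric] mult_ac)
  have "x powr (\<alpha> + 1) / x = x powr \<alpha>"
    using \<open>x \<noteq> 0\<close> by (simp add: powr_add)
  \<comment> \<open>Cancelling \<alpha> + \<beta> + 1 = \<beta> q brings the bracket to the form
    cosh u * A - u/q * sinh u * B of the general derivative lemma.\<close>
  moreover have "y powr (\<alpha> + 1) / ((\<alpha> + 1) * (\<beta> * q)) * (\<beta> * q * c * A - \<beta> * \<eta> * y powr \<beta> * t * B)
      = y powr (\<alpha> + 1) / (\<alpha> + 1) * (c * A - \<eta> * y powr \<beta> / q * t * B)" for y c A t B
    using \<open>\<beta> \<noteq> 0\<close> \<open>q \<noteq> 0\<close> \<open>\<alpha> + 1 \<noteq> 0\<close> by (simp add: divide_simps) (simp add: algebra_simps)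
  moreover have "(\<alpha> + 1) / \<beta> + 2 = q + 1" "(\<alpha> + 1) / \<beta> + 3 = q + 2"
    by (simp_all add: q_def)
  ultimately show "((\<lambda>x. x powr (\<alpha> + 1) / ((\<alpha> + 1) * (\<alpha> + \<beta> + 1)) *
      ((\<alpha> + \<beta> + 1) * cosh (\<eta> * x powr \<beta>) *
         hypergeom_1F2 1 ((\<alpha> + \<beta> + 1) / (2 * \<beta>)) ((\<alpha> + 2 * \<beta> + 1) / (2 * \<beta>))
           (\<eta>\<^sup>2 * x powr (2 * \<beta>) / 4)
       - \<beta> * \<eta> * x powr \<beta> * sinh (\<eta> * x powr \<beta>) *
         hypergeom_1F2 1 ((\<alpha> + 2 * \<beta> + 1) / (2 * \<beta>)) ((\<alpha> + 3 * \<beta> + 1) / (2 * \<beta>))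
           (\<eta>\<^sup>2 * x powr (2 * \<beta>) / 4)))
      has_field_derivative x powr \<alpha> * cosh (\<eta> * x powr \<beta>)) (at x within S)"
    using DERIV_cosh_sinh_hypergeom_1F2[OF \<open>\<beta> \<noteq> 0\<close> \<open>\<alpha> + 1 \<noteq> 0\<close> q[unfolded q_def] \<open>x \<noteq> 0\<close>
        powr[of "\<alpha> + 1"] u]
    unfolding params unfolding \<beta>_q u_sq q_def[symmetric] by (simp only:)
qed

end
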